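(* Let $K$ be an algebraically closed field with a nontrivial non-Archimedean valuation. (i) For $n=1$, for every finite quiver $Q$, every $Q$-representation $R$ with $R_i=K^1$ for all vertices $i$, and every dimension vector $\mathbf{d}$, one has $\operatorname{QDr}(R,\mathbf{d};1)=\overline{\operatorname{trop}}(\operatorname{QGr}(R,\mathbf{d};1))$. (ii) For every $n\ge2$, for every finite quiver $Q$, $Q$-representation $R$ with $R_i=K^n$ and dimension vector $\mathbf{d}$, one has $\overline{\operatorname{trop}}(\operatorname{QGr}(R,\mathbf{d};n))\subseteq\operatorname{QDr}(R,\mathbf{d};n)$, and there exist a finite quiver $Q$, a $Q$-representation $R$ with $R_i=K^n$, and a dimension vector $\mathbf{d}$ for which this containment is strict.
   Context: A finite quiver $Q=(V,A,s,t)$; a $Q$-representation $R$ assigns $R_i=K^n$ to each vertex and a matrix $A^{\alpha}\in K^{n\times n}$ to each arrow $\alpha$. A dimension vector is $\mathbf{d}=(d_i)_{i\in V}$ with $0\le d_i\le n$. A subrepresentation consists of subspaces $N_i\subseteq K^n$ with $A^\alpha N_{s(\alpha)}\subseteq N_{t(\alpha)}$. $\operatorname{QGr}(R,\mathbf{d};n)$ is the set of subrepresentations with $\dim N_i=d_i$, embedded in $\prod_i\mathbb{P}^{\binom{n}{d_i}-1}$ via Plücker coordinates; $\overline{\operatorname{trop}}(\operatorname{QGr}(R,\mathbf{d};n))$ is the Euclidean closure in $\prod_i\mathbb{P}(\mathbb{T}^{\binom{n}{d_i}})$ of the coordinatewise valuations of its points, where $\mathbb{T}=\mathbb{R}\cup\{\infty\}$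 and $\mathbb{P}(\mathbb{T}^N)=(\mathbb{T}^N\setminus\{(\infty,\dots,\infty)\})/\mathbb{R}\mathbf{1}$. Quiver Dressian $\operatorname{QDr}(R,\mathbf{d};n)$: tuples $(p^{(i)})_{i\in V}$, $p^{(i)}\in\mathbb{P}(\mathbb{T}^{\binom{n}{d_i}})$, such that for each vertex $i$ ($r=d_i$) and all $I\in\binom{[n]}{r-1}$, $J\in\binom{[n]}{r+1}$ the minimum $\min_{j\in J\setminus I}(p^{(i)}_{I\cup j}+p^{(i)}_{J\setminus j})$ is attained at least twice, and for each arrow $\alpha$ ($r=d_{s(\alpha)}$, $s=d_{t(\alpha)}$) and all $I\in\binom{[n]}{r-1}$, $J\in\binom{[n]}{s+1}$ the minimum $\min_{j\in[n]\setminus I,i\in J}(\mathrm{val}(A^{\alpha}_{i,j})+p^{(s(\alpha))}_{I\cup j}+p^{(t(\alpha))}_{J\setminus i})$ is attained at least twice (a minimum equal to $\infty$ counts as attained twice). These are the tropicalizations of the Grassmann–Plücker relations and of the quiver Plücker relations $\sum_{j\in[n]\setminus I,i\in J}\pm(A^\alpha)_{i,j}p_{I\cup j}p_{J\setminus i}$, whose common zero set is $\operatorname{QGr}(R,\mathbf{d};n)$. *)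

theory Defs
  imports "HOL-Analysis.Analysis" "HOL-Computational_Algebra.Polynomial"
begin

definition alg_closed :: "('k::field) itself \<Rightarrow> bool" where
  "alg_closed _ \<longleftrightarrow> (\<forall>p :: 'k poly. degree p \<ge> 1 \<longrightarrow> (\<exists>z. poly p z = 0))"

definition nonarch_valuation :: "('k::field \<Rightarrow> ereal) \<Rightarrow> bool" where
  "nonarch_valuation val \<longleftrightarrow>
     (\<forall>x. val x = \<infinity> \<longleftrightarrow> x = 0) \<and>
     (\<forall>x. val x \<noteq> -\<infinity>) \<and>
     (\<forall>x y. val (x * y) = val x + val y) \<and>
     (\<forall>x y. min (val x) (val y) \<le> val (x + y))"

definition nontrivial_valuation :: "('k::field \<Rightarrow> ereal) \<Rightarrow> bool" where
  "nontrivial_valuation val \<longleftrightarrow> (\<exists>x. x \<noteq> 0 \<and> val x \<noteq> 0)"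

text \<open>A finite quiver: finite vertex set V, finite arrow set Arr (both labelled by
  natural numbers), source and target maps src, tgt. A dimension vector d with
  0 <= d i <= n for all vertices.  A representation with R_i = K^n is given by
  n x n matrices A alpha (entries A alpha i j for i, j < n; other entries are irrelevant).\<close>
definition quiver_dimvec :: "nat set \<Rightarrow> nat set \<Rightarrow> (nat \<Rightarrow> nat) \<Rightarrow> (nat \<Rightarrow> nat)
    \<Rightarrow> nat \<Rightarrow> (nat \<Rightarrow> nat) \<Rightarrow> bool" where
  "quiver_dimvec V Arr src tgt n d \<longleftrightarrow>
     finite V \<and> finite Arr \<and> (\<forall>a\<in>Arr. src a \<in> V \<and> tgt a \<in> V) \<and> (\<forall>i\<in>V. d i \<le> n)"

definition kvecs :: "nat \<Rightarrow> (nat \<Rightarrow> 'k::field) set" where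
  "kvecs n = {v. \<forall>j\<ge>n. v j = 0}"

definition matvec :: "nat \<Rightarrow> (nat \<Rightarrow> nat \<Rightarrow> 'k::field) \<Rightarrow> (nat \<Rightarrow> 'k) \<Rightarrow> (nat \<Rightarrow> 'k)" where
  "matvec n A v = (\<lambda>i. if i < n then (\<Sum>j<n. A i j * v j) else 0)"

definition rowcomb :: "nat \<Rightarrow> (nat \<Rightarrow> nat \<Rightarrow> 'k::field) \<Rightarrow> (nat \<Rightarrow> 'k) \<Rightarrow> (nat \<Rightarrow> 'k)" where
  "rowcomb r M c = (\<lambda>j. \<Sum>k<r. c k * M k j)"

definition basis_matrix :: "nat \<Rightarrow> nat \<Rightarrow> (nat \<Rightarrow> nat \<Rightarrow> 'k::field) \<Rightarrow> (nat \<Rightarrow> 'k) set \<Rightarrow> bool" where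
  "basis_matrix n r M N \<longleftrightarrow>
     (\<forall>k j. n \<le> j \<longrightarrow> M k j = 0) \<and>
     (\<forall>c. rowcomb r M c = (\<lambda>_. 0) \<longrightarrow> (\<forall>k<r. c k = 0)) \<and>
     N = range (rowcomb r M)"

definition subspace_of_dim :: "nat \<Rightarrow> nat \<Rightarrow> (nat \<Rightarrow> 'k::field) set \<Rightarrow> bool" where
  "subspace_of_dim n r N \<longleftrightarrow> (\<exists>M. basis_matrix n r M N)"

definition ldet :: "nat \<Rightarrow> (nat \<Rightarrow> nat \<Rightarrow> 'k::field) \<Rightarrow> 'k" where
  "ldet r B = (\<Sum>p\<in>{p. p permutes {..<r}}. of_int (sign p) * (\<Prod>k<r. B k (p k)))"

definition plucker :: "nat \<Rightarrow> (nat \<Rightarrow> nat \<Rightarrow> 'k::field) \<Rightarrow> nat set \<Rightarrow> 'k" where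
  "plucker r M I = ldet r (\<lambda>k l. M k (sorted_list_of_set I ! l))"

definition subsets_of_size :: "nat \<Rightarrow> nat \<Rightarrow> nat set set" where
  "subsets_of_size n r = {I. I \<subseteq> {..<n} \<and> card I = r}"

definition QGr :: "nat set \<Rightarrow> nat set \<Rightarrow> (nat \<Rightarrow> nat) \<Rightarrow> (nat \<Rightarrow> nat)
    \<Rightarrow> (nat \<Rightarrow> nat \<Rightarrow> nat \<Rightarrow> 'k::field) \<Rightarrow> (nat \<Rightarrow> nat) \<Rightarrow> nat \<Rightarrow> (nat \<Rightarrow> (nat \<Rightarrow> 'k) set) set" where
  "QGr V Arr src tgt A d n =
     {N. (\<forall>i\<in>V. subspace_of_dim n (d i) (N i)) \<and>
         (\<forall>a\<in>Arr. matvec n (A a) ` N (src a) \<subseteq> N (tgt a))}"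

text \<open>A point of prod_{i in V} P(T^{binom(n, d_i)}) is represented by a representative
  x :: nat => nat set => ereal, where x i I is the I-th coordinate at vertex i.
  Canonical conventions: coordinates not indexed by a vertex i in V and a set
  I in binom([n], d_i) are infinity.  A subset of the tropical product space is
  represented by the set of all representatives of its points (which is stable under
  adding a real constant c_i to all coordinates at vertex i).\<close>

definition trop_rep :: "nat set \<Rightarrow> (nat \<Rightarrow> nat) \<Rightarrow> nat \<Rightarrow> (nat \<Rightarrow> nat set \<Rightarrow> ereal) \<Rightarrow> bool" where
  "trop_rep V d n x \<longleftrightarrow>
     (\<forall>i I. (i \<notin> V \<or> I \<notin> subsets_of_size n (d i)) \<longrightarrow> x i I = \<infinity>) \<and>
     (\<forall>i I. x i I \<noteq> -\<infinity>) \<and>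
     (\<forall>i\<in>V. \<exists>I. x i I \<noteq> \<infinity>)"

definition trop_QGr :: "('k::field \<Rightarrow> ereal) \<Rightarrow> nat set \<Rightarrow> nat set \<Rightarrow> (nat \<Rightarrow> nat) \<Rightarrow> (nat \<Rightarrow> nat)
    \<Rightarrow> (nat \<Rightarrow> nat \<Rightarrow> nat \<Rightarrow> 'k) \<Rightarrow> (nat \<Rightarrow> nat) \<Rightarrow> nat \<Rightarrow> (nat \<Rightarrow> nat set \<Rightarrow> ereal) set" where
  "trop_QGr val V Arr src tgt A d n =
     {x. \<exists>N\<in>QGr V Arr src tgt A d n. \<exists>M c.
          (\<forall>i\<in>V. basis_matrix n (d i) (M i) (N i)) \<and>
          (\<forall>i I. x i I = (if i \<in> V \<and> I \<in> subsets_of_size n (d i)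
                           then val (plucker (d i) (M i) I) + ereal (c i) else \<infinity>))}"

text \<open>Euclidean closure in prod_i P(T^{binom(n,d_i)}).  Since the quotient map
  T^N - {infinity vector} -> P(T^N) is open and trop_QGr is saturated, this is the closure
  of the set of representatives (in the product topology of the extended reals)
  intersected with the set of valid representatives.\<close>
definition trop_closure_QGr :: "('k::field \<Rightarrow> ereal) \<Rightarrow> nat set \<Rightarrow> nat set \<Rightarrow> (nat \<Rightarrow> nat) \<Rightarrow> (nat \<Rightarrow> nat)
    \<Rightarrow> (nat \<Rightarrow> nat \<Rightarrow> nat \<Rightarrow> 'k) \<Rightarrow> (nat \<Rightarrow> nat) \<Rightarrow> nat \<Rightarrow> (nat \<Rightarrow> nat set \<Rightarrow> ereal) set" where
  "trop_closure_QGr val V Arr src tgt A d n =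
     closure (trop_QGr val V Arr src tgt A d n) \<inter> {x. trop_rep V d n x}"

text \<open>The minimum of f over S is attained at least twice (a minimum equal to infinity,
  including the empty minimum, counts as attained twice).\<close>
definition min_twice :: "'a set \<Rightarrow> ('a \<Rightarrow> ereal) \<Rightarrow> bool" where
  "min_twice S f \<longleftrightarrow>
     (INF s\<in>S. f s) = \<infinity> \<or>
     (\<exists>a\<in>S. \<exists>b\<in>S. a \<noteq> b \<and> f a = (INF s\<in>S. f s) \<and> f b = (INF s\<in>S. f s))"

definition QDr :: "('k::field \<Rightarrow> ereal) \<Rightarrow> nat set \<Rightarrow> nat set \<Rightarrow> (nat \<Rightarrow> nat) \<Rightarrow> (nat \<Rightarrow> nat)
    \<Rightarrow> (nat \<Rightarrow> nat \<Rightarrow> nat \<Rightarrow> 'k) \<Rightarrow> (nat \<Rightarrow> nat) \<Rightarrow> nat \<Rightarrow> (nat \<Rightarrow> nat set \<Rightarrow> ereal) set" where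
  "QDr val V Arr src tgt A d n =
     {x. trop_rep V d n x \<and>
         (\<forall>i\<in>V. \<forall>I J. I \<in> subsets_of_size n (d i - 1) \<and> 1 \<le> d i \<and>
                       J \<in> subsets_of_size n (d i + 1) \<longrightarrow>
            min_twice (J - I) (\<lambda>j. x i (insert j I) + x i (J - {j}))) \<and>
         (\<forall>a\<in>Arr. \<forall>I J. I \<in> subsets_of_size n (d (src a) - 1) \<and> 1 \<le> d (src a) \<and>
                       J \<in> subsets_of_size n (d (tgt a) + 1) \<longrightarrow>
            min_twice (({..<n} - I) \<times> J)
              (\<lambda>(j, k). val (A a k j) + x (src a) (insert j I) + x (tgt a) (J - {k})))}"

end

theory Submission
  imports Defs "Jordan_Normal_Form.Determinant"
begin

text \<open>The signed Pluecker coordinates \<open>p\<^bsub>I \<union> j\<^esub>\<close> of a subspace form a vector \<open>v\<close> of it, and the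
  coordinates \<open>p\<^bsub>J - k\<^esub>\<close> are the coefficients of a linear equation that it satisfies. Evaluating
  the equations of the target space at \<open>A v\<close> gives the quiver Pluecker relations; the
  Grassmann--Pluecker relations are those of the identity map, also tropically. A vanishing sum
  attains its minimal valuation at least twice, and this survives limits because a unique finite
  minimum is an open condition.

  If all dimensions are 0 or n, which is always so for \<open>n = 1\<close>, then the only conditions are that
  the arrows from dimension n to dimension 0 vanish, in the Dressian as well as in the Grassmannian.
  For \<open>n \<ge> 2\<close> the containment is strict for a single loop carrying the shear \<open>1 + E\<^sub>0\<^sub>1\<close>, in
  dimension 1: the diagonal terms of its relations cancel algebraically but not tropically, so the
  Dressian contains the origin, although \<open>p\<^sub>1 = 0\<close> on the only invariant lines.\<close>

subsection \<open>Laplace expansion of Pluecker coordinates\<close>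

lemma ldet_eq_det: "ldet r B = Determinant.det (Matrix.mat r r (\<lambda>(i, j). B i j))"
proof -
  have "(\<Prod>k<r. B k (p k)) = (\<Prod>k<r. Matrix.mat r r (\<lambda>(i, j). B i j) $$ (k, p k))"
    if "p permutes {..<r}" for p
    using permutes_in_image[OF that] by (intro prod.cong) auto
  then show ?thesis
    by (simp add: ldet_def Determinant.det_def atLeast0LessThan)
qed

lemma ldet_identical_rows:
  assumes "i < r" "i' < r" "i \<noteq> i'" "\<And>l. l < r \<Longrightarrow> B i l = B i' l"
  shows "ldet r B = 0"
  unfolding ldet_eq_det using assms
  by (intro det_identical_rows[of _ r i i']) (auto intro!: eq_vecI)

lemma ldet_identical_columns:
  assumes "l < r" "l' < r" "l \<noteq> l'" "\<And>k. k < r \<Longrightarrow> B k l = B k l'"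
  shows "ldet r B = 0"
  unfolding ldet_eq_det using assms
  by (intro det_identical_columns[of _ r l l']) (auto intro!: eq_vecI)

lemma cofactor_eq_ldet:
  assumes "i < Suc r" "l < Suc r"
  shows "cofactor (Matrix.mat (Suc r) (Suc r) (\<lambda>(i, j). B i j)) i l =
    (- 1) ^ (i + l) * ldet r (\<lambda>k m. B (insert_index i k) (insert_index l m))"
proof -
  have "mat_delete (Matrix.mat (Suc r) (Suc r) (\<lambda>(i, j). B i j)) i l =
      Matrix.mat r r (\<lambda>(k, m). B (insert_index i k) (insert_index l m))"
    using assms by (intro eq_matI) (auto simp: mat_delete_def insert_index_def)
  then show ?thesis
    by (simp add: cofactor_def ldet_eq_det)
qed

lemma ldet_laplace_column:
  assumes "l < Suc r"
  shows "ldet (Suc r) B =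
    (\<Sum>i<Suc r. (- 1) ^ (i + l) * B i l * ldet r (\<lambda>k m. B (insert_index i k) (insert_index l m)))"
  unfolding ldet_eq_det[of "Suc r"] using assms
  by (subst laplace_expansion_column[OF mat_carrier assms])
    (intro sum.cong, auto simp: cofactor_eq_ldet simp del: sum.lessThan_Suc)

lemma ldet_laplace_row:
  assumes "i < Suc r"
  shows "ldet (Suc r) B =
    (\<Sum>l<Suc r. (- 1) ^ (i + l) * B i l * ldet r (\<lambda>k m. B (insert_index i k) (insert_index l m)))"
  unfolding ldet_eq_det[of "Suc r"] using assms
  by (subst laplace_expansion_row[OF mat_carrier assms])
    (intro sum.cong, auto simp: cofactor_eq_ldet simp del: sum.lessThan_Suc)

lemma nth_sorted_list_of_set_diff:
  assumes "finite J" and l: "l < card J"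
  shows "sorted_list_of_set (J - {sorted_list_of_set J ! l}) ! m =
    sorted_list_of_set J ! insert_index l m"
proof -
  define js where "js = sorted_list_of_set J"
  have js: "js = take l js @ js ! l # drop (Suc l) js"
    using l by (intro id_take_nth_drop) (simp add: js_def)
  moreover have "distinct js"
    by (simp add: js_def)
  ultimately have "js ! l \<notin> set (take l js)"
    by (metis distinct_append disjoint_iff list.set_intros(1))
  then have "remove1 (js ! l) js = take l js @ drop (Suc l) js"
    by (subst (2) js) (simp add: remove1_append)
  then have "sorted_list_of_set (J - {js ! l}) = take l js @ drop (Suc l) js"
    using assms by (simp add: js_def sorted_list_of_set_remove)
  then show ?thesis
    using l unfolding js_def[symmetric] by (auto simp: nth_append insert_index_def js_def)
qed

definition position_sign :: "nat set \<Rightarrow> nat \<Rightarrow> 'k::comm_ring_1" where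
  "position_sign J j = (- 1) ^ card {i \<in> J. i < j}"

lemma position_sign_squared: "position_sign J j * position_sign J j = 1"
  by (simp add: position_sign_def)

lemma position_sign_insert: "position_sign (insert j J) j = position_sign J j"
proof -
  have "{i \<in> insert j J. i < j} = {i \<in> J. i < j}"
    by auto
  then show ?thesis
    by (simp add: position_sign_def)
qed

lemma position_sign_nth:
  assumes "finite J" "l < card J"
  shows "position_sign J (sorted_list_of_set J ! l) = (- 1) ^ l"
proof -
  define js where "js = sorted_list_of_set J"
  have js: "sorted_wrt (<) js" "distinct js" "length js = card J" "set js = J"
    using assms(1) by (simp_all add: js_def)
  have "js ! i < js ! l \<longleftrightarrow> i < l" if "i < card J" for i
    using sorted_wrt_nth_less[OF js(1), of i l] sorted_wrt_nth_less[OF js(1), of l i]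
      js(3) assms(2) that by (cases i l rule: linorder_cases) auto
  moreover have "(!) js ` {..<card J} = J"
    using js(3,4) nth_image[of "card J" js] by (simp add: lessThan_atLeast0)
  ultimately have "{j \<in> J. j < js ! l} = (!) js ` {..<l}"
    using assms(2) by fastforce
  moreover have "inj_on ((!) js) {..<l}"
    using js assms(2) by (intro inj_on_nth) auto
  ultimately show ?thesis
    by (simp add: position_sign_def card_image flip: js_def)
qed

lemma ex_nth_sorted_list_of_set:
  assumes "finite J" "j \<in> J"
  shows "\<exists>l<card J. sorted_list_of_set J ! l = j"
  using assms by (metis in_set_conv_nth sorted_list_of_set.length_sorted_key_list_of_set
      sorted_list_of_set.set_sorted_key_list_of_set)

lemma plucker_diff_nth:
  assumes "finite J" "card J = Suc r" "l < Suc r"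
  shows "plucker r M (J - {sorted_list_of_set J ! l}) =
    ldet r (\<lambda>k m. M k (sorted_list_of_set J ! insert_index l m))"
  unfolding plucker_def using assms by (simp add: nth_sorted_list_of_set_diff)

lemma plucker_laplace_row:
  assumes "finite J" "card J = Suc r" "i < Suc r"
  shows "plucker (Suc r) M J =
    (\<Sum>j\<in>J. (- 1) ^ i * position_sign J j * M i j * plucker r (M \<circ> insert_index i) (J - {j}))"
proof -
  let ?js = "sorted_list_of_set J"
  have bij: "bij_betw ((!) ?js) {..<Suc r} J"
    using assms by (intro bij_betw_nth) auto
  have "plucker (Suc r) M J = (\<Sum>l<Suc r. (- 1) ^ i * position_sign J (?js ! l) * M i (?js ! l) *
      plucker r (M \<circ> insert_index i) (J - {?js ! l}))"
    unfolding plucker_def[of "Suc r"] ldet_laplace_row[OF assms(3)] using assms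
    by (intro sum.cong) (auto simp: position_sign_nth plucker_diff_nth power_add)
  also have "\<dots> = (\<Sum>j\<in>J. (- 1) ^ i * position_sign J j * M i j *
      plucker r (M \<circ> insert_index i) (J - {j}))"
    by (rule sum.reindex_bij_betw[OF bij])
  finally show ?thesis .
qed

lemma plucker_laplace_column:
  assumes "finite J" "card J = Suc r" "j \<in> J"
  shows "plucker (Suc r) M J = position_sign J j *
    (\<Sum>i<Suc r. (- 1) ^ i * M i j * plucker r (M \<circ> insert_index i) (J - {j}))"
proof -
  obtain l where l: "l < Suc r" "sorted_list_of_set J ! l = j"
    using ex_nth_sorted_list_of_set[OF assms(1,3)] assms(2) by auto
  show ?thesis
    unfolding plucker_def[of "Suc r"] ldet_laplace_column[OF l(1)] sum_distrib_left using assms l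
    by (intro sum.cong) (auto simp: position_sign_nth[of J l, unfolded l(2)]
        plucker_diff_nth[of J r l, unfolded l(2)] power_add mult_ac)
qed

subsection \<open>The quiver Pluecker relations\<close>

definition plucker_vector :: "nat \<Rightarrow> (nat \<Rightarrow> nat \<Rightarrow> 'k::field) \<Rightarrow> nat set \<Rightarrow> nat \<Rightarrow> 'k" where
  "plucker_vector r M I j =
     (if j \<in> I then 0 else position_sign I j * plucker r M (insert j I))"

text \<open>Combining the rows with the signed minors of the columns \<open>I\<close> as coefficients yields at
  \<open>j\<close> the determinant of the columns \<open>I\<close> together with the column \<open>j\<close>.\<close>
lemma plucker_vector_in_row_space:
  assumes "finite I" "Suc (card I) = r"
  shows "plucker_vector r M I \<in> range (rowcomb r M)"
proof -
  obtain r' where r: "r = Suc r'" and I: "card I = r'"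
    using assms(2) by auto
  define minor where "minor i = (- 1) ^ i * plucker r' (M \<circ> insert_index i) I" for i
  have "rowcomb r M minor j = plucker_vector r M I j" for j
  proof (cases "j \<in> I")
    case True
    let ?js = "sorted_list_of_set I"
    obtain l where l: "l < r'" "?js ! l = j"
      using ex_nth_sorted_list_of_set[OF assms(1) True] I by auto
    have "rowcomb r M minor j = ldet (Suc r') (\<lambda>k m. M k ((j # ?js) ! m))"
      by (subst ldet_laplace_column[of 0])
        (simp_all add: r rowcomb_def minor_def plucker_def mult_ac del: sum.lessThan_Suc)
    also have "\<dots> = 0"
      using l by (intro ldet_identical_columns[of 0 _ "Suc l"]) auto
    finally show ?thesis
      using True by (simp add: plucker_vector_def)
  next
    case False
    then have "plucker r M (insert j I) = position_sign I j * rowcomb r M minor j"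
      using assms I plucker_laplace_column[of "insert j I" r' j M]
      by (simp add: r position_sign_insert rowcomb_def minor_def mult_ac del: sum.lessThan_Suc)
    with False show ?thesis
      by (simp add: plucker_vector_def position_sign_squared flip: mult.assoc)
  qed
  then show ?thesis
    by (metis ext rangeI)
qed

text \<open>The sum is the Laplace expansion of the minor \<open>J\<close> of \<open>M\<close> with the dependent
  row \<open>w\<close> added on top.\<close>
lemma plucker_equation_of_row_space:
  assumes "finite J" "card J = Suc s" "w \<in> range (rowcomb s M)"
  shows "(\<Sum>k\<in>J. position_sign J k * w k * plucker s M (J - {k})) = 0"
proof -
  define eqn where "eqn u = (\<Sum>k\<in>J. position_sign J k * u k * plucker s M (J - {k}))" for u
  have "case_nat u M \<circ> insert_index 0 = M" for u
    by (simp add: fun_eq_iff)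
  then have eqn: "eqn u = plucker (Suc s) (case_nat u M) J" for u
    using assms by (simp add: plucker_laplace_row[of J s 0] eqn_def)
  have "eqn (M i) = 0" if "i < s" for i
    unfolding eqn plucker_def using that by (intro ldet_identical_rows[of 0 _ "Suc i"]) auto
  moreover have "eqn (rowcomb s M c) = (\<Sum>i<s. c i * eqn (M i))" for c
    unfolding eqn_def rowcomb_def
    by (simp add: sum_distrib_left sum_distrib_right mult_ac sum.swap[of _ J])
  ultimately show ?thesis
    using assms(3) by (auto simp: eqn_def)
qed

lemma quiver_plucker_relation:
  assumes map: "matvec n A ` range (rowcomb r M) \<subseteq> range (rowcomb s M')"
    and I: "finite I" "Suc (card I) = r"
    and J: "J \<subseteq> {..<n}" "card J = Suc s"
  shows "(\<Sum>(j, k)\<in>({..<n} - I) \<times> J. position_sign I j * position_sign J k *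
    (A k j * plucker r M (insert j I) * plucker s M' (J - {k}))) = 0"
proof -
  define w where "w = matvec n A (plucker_vector r M I)"
  have w: "w k = (\<Sum>j\<in>{..<n} - I. A k j * (position_sign I j * plucker r M (insert j I)))"
    if "k \<in> J" for k
  proof -
    have "w k = (\<Sum>j<n. A k j * plucker_vector r M I j)"
      using that J(1) by (auto simp: w_def matvec_def)
    also have "\<dots> = (\<Sum>j\<in>{..<n} - I. A k j * plucker_vector r M I j)"
      by (intro sum.mono_neutral_right) (auto simp: plucker_vector_def)
    finally show ?thesis
      by (simp add: plucker_vector_def)
  qed
  have "(\<Sum>(j, k)\<in>({..<n} - I) \<times> J. position_sign I j * position_sign J k *
      (A k j * plucker r M (insert j I) * plucker s M' (J - {k})))
    = (\<Sum>k\<in>J. position_sign J k * w k * plucker s M' (J - {k}))"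
    unfolding sum.cartesian_product[symmetric]
    by (subst sum.swap, intro sum.cong) (auto simp: w sum_distrib_left sum_distrib_right mult_ac)
  also have "\<dots> = 0"
  proof (rule plucker_equation_of_row_space)
    show "w \<in> range (rowcomb s M')"
      using map plucker_vector_in_row_space[OF I, of M] by (auto simp: w_def)
  qed (use J finite_subset in auto)
  finally show ?thesis .
qed

subsection \<open>Minima attained twice\<close>

lemma min_twice_iff:
  assumes "finite S"
  shows "min_twice S f \<longleftrightarrow> (\<forall>a\<in>S. f a < \<infinity> \<longrightarrow> (\<exists>b\<in>S - {a}. f b \<le> f a))"
proof (intro iffI ballI impI)
  fix a assume "min_twice S f" and a: "a \<in> S" "f a < \<infinity>"
  have "(INF s\<in>S. f s) \<le> f a"
    using a(1) by (rule INF_lower)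
  then obtain b c where "b \<in> S" "c \<in> S" "b \<noteq> c" "f b \<le> f a" "f c \<le> f a"
    using \<open>min_twice S f\<close> a(2) unfolding min_twice_def by force
  then show "\<exists>b\<in>S - {a}. f b \<le> f a"
    by (cases "b = a") auto
next
  assume twice: "\<forall>a\<in>S. f a < \<infinity> \<longrightarrow> (\<exists>b\<in>S - {a}. f b \<le> f a)"
  show "min_twice S f"
  proof (cases "(INF s\<in>S. f s) = \<infinity>")
    case False
    then have "S \<noteq> {}"
      by (auto simp: top_ereal_def)
    then obtain a where a: "a \<in> S" "f a = (INF s\<in>S. f s)"
      using finite_Inf_in[of "f ` S"] assms by (force simp: inf_min min_def)
    with False have "f a < \<infinity>"
      by simp
    with twice a(1) obtain b where b: "b \<in> S" "a \<noteq> b" "f b \<le> f a"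
      by blast
    moreover have "f b = (INF s\<in>S. f s)"
      using a b INF_lower[of b S f] by simp
    ultimately show ?thesis
      using a unfolding min_twice_def by blast
  qed (simp add: min_twice_def)
qed

lemma min_twiceI:
  assumes "a \<in> S" "b \<in> S" "a \<noteq> b" "f a = f b" "\<And>s. s \<in> S \<Longrightarrow> f a \<le> f s"
  shows "min_twice S f"
proof -
  have "(INF s\<in>S. f s) = f a"
    using assms by (intro antisym INF_lower INF_greatest) auto
  with assms show ?thesis
    unfolding min_twice_def by metis
qed

lemma min_twice_singleton: "min_twice {a} f \<longleftrightarrow> f a = \<infinity>"
  by (auto simp: min_twice_def)

lemma min_twice_cong:
  assumes "\<And>s. s \<in> S \<Longrightarrow> f s = g s"
  shows "min_twice S f \<longleftrightarrow> min_twice S g"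
  using assms by (simp add: min_twice_def cong: INF_cong bex_cong)

lemma min_twice_add_ereal:
  assumes "finite S"
  shows "min_twice S (\<lambda>s. f s + ereal c) \<longleftrightarrow> min_twice S f"
  using assms by (simp add: min_twice_iff ereal_add_le_add_iff2)

lemma min_twice_reindex:
  assumes h: "inj_on h T" "h ` T \<subseteq> S" and infinite: "\<And>s. s \<in> S - h ` T \<Longrightarrow> f s = \<infinity>"
  shows "min_twice S f \<longleftrightarrow> min_twice T (\<lambda>t. f (h t))"
proof -
  have "(INF s\<in>S. f s) = (INF t\<in>T. f (h t))"
  proof (intro antisym INF_greatest)
    show "(INF t\<in>T. f (h t)) \<le> f s" if "s \<in> S" for s
      using that infinite by (cases "s \<in> h ` T") (auto intro: INF_lower)
  qed (use h(2) in \<open>auto intro: INF_lower\<close>)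
  moreover have "(\<exists>a\<in>S. \<exists>b\<in>S. a \<noteq> b \<and> f a = m \<and> f b = m) \<longleftrightarrow>
      (\<exists>t\<in>T. \<exists>u\<in>T. t \<noteq> u \<and> f (h t) = m \<and> f (h u) = m)" if "m \<noteq> \<infinity>" for m
  proof -
    have "s \<in> h ` T" if "s \<in> S" "f s = m" for s
      using infinite that \<open>m \<noteq> \<infinity>\<close> by blast
    then have "(\<exists>a\<in>S. \<exists>b\<in>S. a \<noteq> b \<and> f a = m \<and> f b = m) \<longleftrightarrow>
        (\<exists>a\<in>h ` T. \<exists>b\<in>h ` T. a \<noteq> b \<and> f a = m \<and> f b = m)"
      using h(2) by (meson subsetD)
    also have "\<dots> \<longleftrightarrow> (\<exists>t\<in>T. \<exists>u\<in>T. t \<noteq> u \<and> f (h t) = m \<and> f (h u) = m)"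
      using inj_on_eq_iff[OF h(1)] by (simp cong: bex_cong)
    finally show ?thesis .
  qed
  ultimately show ?thesis
    unfolding min_twice_def by (cases "(INF s\<in>S. f s) = \<infinity>") simp_all
qed

lemma min_twice_tendsto:
  assumes fin: "finite S" and lim: "\<And>s. s \<in> S \<Longrightarrow> ((\<lambda>y. F y s) \<longlongrightarrow> f s) G"
    and freq: "\<exists>\<^sub>F y in G. min_twice S (F y)"
  shows "min_twice S f"
proof (rule ccontr)
  assume "\<not> min_twice S f"
  then obtain a where a: "a \<in> S" "f a < \<infinity>" and less: "\<And>b. b \<in> S - {a} \<Longrightarrow> f a < f b"
    unfolding min_twice_iff[OF fin] by (meson not_le)
  have "\<forall>\<^sub>F y in G. F y a < F y b" if b: "b \<in> S - {a}" for b
  proof -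
    obtain m where m: "f a < m" "m < f b"
      using less[OF b] dense by blast
    have "\<forall>\<^sub>F y in G. F y a < m" "\<forall>\<^sub>F y in G. m < F y b"
      using order_tendstoD[OF lim] a(1) b m by auto
    then show ?thesis
      by eventually_elim simp
  qed
  then have "\<forall>\<^sub>F y in G. \<forall>b\<in>S - {a}. F y a < F y b"
    using fin by (intro eventually_ball_finite) auto
  moreover have "\<forall>\<^sub>F y in G. F y a < \<infinity>"
    using order_tendstoD(2)[OF lim] a by blast
  ultimately have "\<forall>\<^sub>F y in G. \<not> min_twice S (F y)"
  proof eventually_elim
    case (elim y)
    with a(1) show ?case
      unfolding min_twice_iff[OF fin] by (meson not_le)
  qed
  with freq show False
    by (simp add: frequently_def)
qed

subsection \<open>Valuations\<close>

locale nonarch_valued_field =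
  fixes val :: "'k::field \<Rightarrow> ereal"
  assumes nonarch_valuation: "nonarch_valuation val"
begin

lemma val_eq_PInf_iff: "val x = \<infinity> \<longleftrightarrow> x = 0"
  and val_zero [simp]: "val 0 = \<infinity>"
  and val_neq_MInf [simp]: "val x \<noteq> -\<infinity>"
  and val_mult: "val (x * y) = val x + val y"
  and val_add_ge: "min (val x) (val y) \<le> val (x + y)"
  using nonarch_valuation unfolding nonarch_valuation_def by blast+

lemma val_one [simp]: "val 1 = 0"
  using val_mult[of 1 1] val_eq_PInf_iff[of 1] val_neq_MInf[of 1] by (cases "val 1") auto

lemma val_uminus [simp]: "val (- x) = val x"
proof -
  have "val (-1) + val (-1) = 0"
    using val_mult[of "-1" "-1"] by simp
  then have "val (-1) = 0"
    by (cases "val (-1)") (auto simp: zero_ereal_def)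
  then show ?thesis
    using val_mult[of "-1" x] by simp
qed

lemma val_position_sign_mult: "val (position_sign J j * x) = val x"
  by (cases "even (card {i \<in> J. i < j})") (simp_all add: position_sign_def)

lemma val_sum_greater:
  assumes "finite S" "c < \<infinity>" "\<And>s. s \<in> S \<Longrightarrow> c < val (t s)"
  shows "c < val (\<Sum>s\<in>S. t s)"
  using assms(1,3)
proof (induction S rule: finite_induct)
  case (insert s S)
  then have "c < min (val (t s)) (val (\<Sum>s\<in>S. t s))"
    by simp
  also have "\<dots> \<le> val (t s + (\<Sum>s\<in>S. t s))"
    by (rule val_add_ge)
  finally show ?case
    using insert by simp
qed (use assms(2) in simp)

lemma min_twice_val_of_sum_eq_zero:
  assumes "finite S" "(\<Sum>s\<in>S. t s) = 0"
  shows "min_twice S (\<lambda>s. val (t s))"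
  unfolding min_twice_iff[OF assms(1)]
proof (intro ballI impI, rule ccontr)
  fix a assume a: "a \<in> S" "val (t a) < \<infinity>" and "\<not> (\<exists>b\<in>S - {a}. val (t b) \<le> val (t a))"
  then have "val (t a) < val (\<Sum>s\<in>S - {a}. t s)"
    using assms(1) by (intro val_sum_greater) (auto simp: not_le)
  moreover have "(\<Sum>s\<in>S - {a}. t s) = - t a"
    using assms a(1) by (simp add: sum_diff1)
  ultimately show False
    by simp
qed

end

subsection \<open>Tropical Pluecker relations\<close>

lemma finite_subsets_of_sizeD: "I \<in> subsets_of_size n r \<Longrightarrow> finite I"
  using finite_subset by (auto simp: subsets_of_size_def)

lemma insert_in_subsets_of_size:
  assumes "I \<in> subsets_of_size n (r - 1)" "1 \<le> r" "j < n" "j \<notin> I"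
  shows "insert j I \<in> subsets_of_size n r"
  using assms finite_subsets_of_sizeD[OF assms(1)] by (auto simp: subsets_of_size_def)

lemma diff_in_subsets_of_size:
  assumes "J \<in> subsets_of_size n (s + 1)" "k \<in> J"
  shows "J - {k} \<in> subsets_of_size n s"
  using assms finite_subsets_of_sizeD[OF assms(1)] by (auto simp: subsets_of_size_def)

definition tropical_plucker_relations :: "('k::field \<Rightarrow> ereal) \<Rightarrow> nat \<Rightarrow> (nat \<Rightarrow> nat \<Rightarrow> 'k)
    \<Rightarrow> nat \<Rightarrow> nat \<Rightarrow> (nat set \<Rightarrow> ereal) \<Rightarrow> (nat set \<Rightarrow> ereal) \<Rightarrow> bool" where
  "tropical_plucker_relations val n A r s p q \<longleftrightarrow>
     (\<forall>I J. I \<in> subsets_of_size n (r - 1) \<and> 1 \<le> r \<and> J \<in> subsets_of_size n (s + 1) \<longrightarrow>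
        min_twice (({..<n} - I) \<times> J) (\<lambda>(j, k). val (A k j) + p (insert j I) + q (J - {k})))"

lemma tropical_plucker_relations_translate:
  assumes rel: "tropical_plucker_relations val n A r s p q"
    and p': "\<And>I. I \<in> subsets_of_size n r \<Longrightarrow> p' I = p I + ereal b"
    and q': "\<And>J. J \<in> subsets_of_size n s \<Longrightarrow> q' J = q J + ereal c"
  shows "tropical_plucker_relations val n A r s p' q'"
  unfolding tropical_plucker_relations_def
proof (intro allI impI, elim conjE)
  fix I J
  assume IJ: "I \<in> subsets_of_size n (r - 1)" "1 \<le> r" "J \<in> subsets_of_size n (s + 1)"
  let ?S = "({..<n} - I) \<times> J"
  let ?f = "\<lambda>p q (j, k). val (A k j) + p (insert j I) + q (J - {k})"
  have "?f p' q' t = ?f p q t + ereal (b + c)" if "t \<in> ?S" for t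
    using that IJ by (auto simp: p' q' insert_in_subsets_of_size diff_in_subsets_of_size add_ac
        simp flip: plus_ereal.simps(1))
  then have "min_twice ?S (?f p' q') \<longleftrightarrow> min_twice ?S (\<lambda>t. ?f p q t + ereal (b + c))"
    by (rule min_twice_cong)
  also have "\<dots> \<longleftrightarrow> min_twice ?S (?f p q)"
    using finite_subsets_of_sizeD[OF IJ(3)] by (intro min_twice_add_ereal) auto
  finally show "min_twice ?S (?f p' q')"
    using rel IJ unfolding tropical_plucker_relations_def by blast
qed

lemma (in nonarch_valued_field) tropical_plucker_relations_tendsto:
  assumes p: "\<And>I. ((\<lambda>y. P y I) \<longlongrightarrow> p I) F" "\<And>I. p I \<noteq> -\<infinity>"
    and q: "\<And>J. ((\<lambda>y. Q y J) \<longlongrightarrow> q J) F" "\<And>J. q J \<noteq> -\<infinity>"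
    and freq: "\<exists>\<^sub>F y in F. tropical_plucker_relations val n A r s (P y) (Q y)"
  shows "tropical_plucker_relations val n A r s p q"
  unfolding tropical_plucker_relations_def
proof (intro allI impI, elim conjE)
  fix I J
  assume IJ: "I \<in> subsets_of_size n (r - 1)" "1 \<le> r" "J \<in> subsets_of_size n (s + 1)"
  let ?S = "({..<n} - I) \<times> J"
  let ?f = "\<lambda>p q (j, k). val (A k j) + p (insert j I) + q (J - {k})"
  show "min_twice ?S (?f p q)"
  proof (rule min_twice_tendsto)
    show "finite ?S"
      using finite_subsets_of_sizeD[OF IJ(3)] by blast
    show "((\<lambda>y. ?f (P y) (Q y) t) \<longlongrightarrow> ?f p q t) F" for t
      unfolding case_prod_beta
      by (intro tendsto_add_ereal_nonneg tendsto_const p q) (simp_all add: p q)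
    show "\<exists>\<^sub>F y in F. min_twice ?S (?f (P y) (Q y))"
      using freq by (rule frequently_elim1) (use IJ in \<open>simp add: tropical_plucker_relations_def\<close>)
  qed
qed

lemma (in nonarch_valued_field) tropical_plucker_relations_val_plucker:
  assumes map: "matvec n A ` range (rowcomb r M) \<subseteq> range (rowcomb s M')"
  shows "tropical_plucker_relations val n A r s
    (\<lambda>I. val (plucker r M I)) (\<lambda>J. val (plucker s M' J))"
  unfolding tropical_plucker_relations_def
proof (intro allI impI, elim conjE)
  fix I J
  assume IJ: "I \<in> subsets_of_size n (r - 1)" "1 \<le> r" "J \<in> subsets_of_size n (s + 1)"
  let ?t = "\<lambda>(j, k). position_sign I j * position_sign J k *
    (A k j * plucker r M (insert j I) * plucker s M' (J - {k}))"
  have "finite I" "Suc (card I) = r" "J \<subseteq> {..<n}" "card J = Suc s"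
    using IJ finite_subsets_of_sizeD[OF IJ(1)] by (auto simp: subsets_of_size_def)
  then have "(\<Sum>t\<in>({..<n} - I) \<times> J. ?t t) = 0"
    by (rule quiver_plucker_relation[OF map])
  then have "min_twice (({..<n} - I) \<times> J) (\<lambda>t. val (?t t))"
    using finite_subsets_of_sizeD[OF IJ(3)] by (intro min_twice_val_of_sum_eq_zero) auto
  then show "min_twice (({..<n} - I) \<times> J)
      (\<lambda>(j, k). val (A k j) + val (plucker r M (insert j I)) + val (plucker s M' (J - {k})))"
    unfolding case_prod_beta mult.assoc[of "position_sign _ _"] val_position_sign_mult
    by (simp add: val_mult)
qed

definition unit_matrix :: "nat \<Rightarrow> nat \<Rightarrow> nat \<Rightarrow> 'k::field" where
  "unit_matrix n i j = (if i = j \<and> j < n then 1 else 0)"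

lemma matvec_unit_matrix:
  assumes "v \<in> kvecs n"
  shows "matvec n (unit_matrix n) v = v"
proof -
  have "(\<Sum>j<n. unit_matrix n i j * v j) = (\<Sum>j<n. if i = j then v j else 0)" for i
    by (intro sum.cong) (auto simp: unit_matrix_def)
  then show ?thesis
    using assms by (auto simp: matvec_def kvecs_def fun_eq_iff)
qed

text \<open>Only the diagonal terms of the relations of the identity map are finite.\<close>
lemma (in nonarch_valued_field) tropical_plucker_relations_unit_matrix_iff:
  "tropical_plucker_relations val n (unit_matrix n) r s p q \<longleftrightarrow>
    (\<forall>I J. I \<in> subsets_of_size n (r - 1) \<and> 1 \<le> r \<and> J \<in> subsets_of_size n (s + 1) \<longrightarrow>
       min_twice (J - I) (\<lambda>j. p (insert j I) + q (J - {j})))"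
proof -
  have "min_twice (({..<n} - I) \<times> J)
        (\<lambda>(j, k). val (unit_matrix n k j) + p (insert j I) + q (J - {k}))
      \<longleftrightarrow> min_twice (J - I) (\<lambda>j. p (insert j I) + q (J - {j}))"
    (is "min_twice ?S ?f \<longleftrightarrow> _")
    if J: "J \<in> subsets_of_size n (s + 1)" for I J
  proof -
    have "min_twice ?S ?f \<longleftrightarrow> min_twice (J - I) (\<lambda>j. ?f (j, j))"
      using J by (intro min_twice_reindex) (auto simp: subsets_of_size_def unit_matrix_def inj_on_def)
    also have "\<dots> \<longleftrightarrow> min_twice (J - I) (\<lambda>j. p (insert j I) + q (J - {j}))"
      using J by (intro min_twice_cong) (auto simp: subsets_of_size_def unit_matrix_def)
    finally show ?thesis .
  qed
  then show ?thesis
    unfolding tropical_plucker_relations_def by auto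
qed

lemma (in nonarch_valued_field) mem_QDr_iff:
  "x \<in> QDr val V Arr src tgt A d n \<longleftrightarrow> trop_rep V d n x \<and>
    (\<forall>i\<in>V. tropical_plucker_relations val n (unit_matrix n) (d i) (d i) (x i) (x i)) \<and>
    (\<forall>a\<in>Arr. tropical_plucker_relations val n (A a) (d (src a)) (d (tgt a))
      (x (src a)) (x (tgt a)))"
  unfolding tropical_plucker_relations_unit_matrix_iff
  by (simp add: QDr_def tropical_plucker_relations_def)

subsection \<open>The quiver Dressian contains the tropical quiver Grassmannian\<close>

lemma subspace_of_dim_subset_kvecs:
  assumes "subspace_of_dim n r N"
  shows "N \<subseteq> kvecs n"
  using assms by (auto simp: subspace_of_dim_def basis_matrix_def rowcomb_def kvecs_def)

lemma trop_QGrE: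
  assumes "y \<in> trop_QGr val V Arr src tgt A d n"
  obtains N M c where "N \<in> QGr V Arr src tgt A d n"
    "\<And>i. i \<in> V \<Longrightarrow> basis_matrix n (d i) (M i) (N i)"
    "\<And>i I. i \<in> V \<Longrightarrow> I \<in> subsets_of_size n (d i) \<Longrightarrow>
      y i I = val (plucker (d i) (M i) I) + ereal (c i)"
proof -
  from assms obtain N M c where "N \<in> QGr V Arr src tgt A d n \<and>
      (\<forall>i\<in>V. basis_matrix n (d i) (M i) (N i)) \<and>
      (\<forall>i I. y i I = (if i \<in> V \<and> I \<in> subsets_of_size n (d i)
         then val (plucker (d i) (M i) I) + ereal (c i) else \<infinity>))"
    unfolding trop_QGr_def by blast
  then show ?thesis
    by (intro that[of N M c]) auto
qed

lemma (in nonarch_valued_field) trop_QGr_tropical_plucker_relations: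
  assumes y: "y \<in> trop_QGr val V Arr src tgt A d n"
    and ij: "i \<in> V" "j \<in> V"
    and map: "\<And>N. N \<in> QGr V Arr src tgt A d n \<Longrightarrow> matvec n B ` N i \<subseteq> N j"
  shows "tropical_plucker_relations val n B (d i) (d j) (y i) (y j)"
proof -
  from y obtain N M c where N: "N \<in> QGr V Arr src tgt A d n"
    and M: "\<And>i. i \<in> V \<Longrightarrow> basis_matrix n (d i) (M i) (N i)"
    and y_eq: "\<And>i I. i \<in> V \<Longrightarrow> I \<in> subsets_of_size n (d i) \<Longrightarrow>
      y i I = val (plucker (d i) (M i) I) + ereal (c i)"
    by (rule trop_QGrE) blast
  have "matvec n B ` range (rowcomb (d i) (M i)) \<subseteq> range (rowcomb (d j) (M j))"
    using map[OF N] M ij by (simp add: basis_matrix_def)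
  from tropical_plucker_relations_val_plucker[OF this] show ?thesis
    by (rule tropical_plucker_relations_translate) (simp_all add: y_eq ij)
qed

lemma tendsto_coordinate:
  fixes x :: "'a \<Rightarrow> 'b \<Rightarrow> 'c::topological_space"
  shows "((\<lambda>y. y i I) \<longlongrightarrow> x i I) (nhds x)"
proof -
  have "continuous_on UNIV (\<lambda>y :: 'a \<Rightarrow> 'b \<Rightarrow> 'c. y i I)"
    by (rule continuous_on_product_then_coordinatewise[OF continuous_on_product_coordinates])
  then have "open ((\<lambda>y :: 'a \<Rightarrow> 'b \<Rightarrow> 'c. y i I) -` S)" if "open S" for S
    using that by (rule open_vimage[rotated])
  then show ?thesis
    by (intro topological_tendstoI) (force simp: eventually_nhds)
qed

lemma frequently_nhds_of_closure:
  assumes "x \<in> closure X"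
  shows "\<exists>\<^sub>F y in nhds x. y \<in> X"
  using assms open_Int_closure_eq_empty[of _ X] unfolding frequently_def eventually_nhds by blast

lemma (in nonarch_valued_field) trop_closure_QGr_tropical_plucker_relations:
  assumes x: "x \<in> trop_closure_QGr val V Arr src tgt A d n"
    and ij: "i \<in> V" "j \<in> V"
    and map: "\<And>N. N \<in> QGr V Arr src tgt A d n \<Longrightarrow> matvec n B ` N i \<subseteq> N j"
  shows "tropical_plucker_relations val n B (d i) (d j) (x i) (x j)"
proof -
  have not_MInf: "x k I \<noteq> -\<infinity>" for k I
    using x by (auto simp: trop_closure_QGr_def trop_rep_def)
  have "\<exists>\<^sub>F y in nhds x. y \<in> trop_QGr val V Arr src tgt A d n"
    using x by (intro frequently_nhds_of_closure) (simp add: trop_closure_QGr_def)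
  then have "\<exists>\<^sub>F y in nhds x. tropical_plucker_relations val n B (d i) (d j) (y i) (y j)"
    by (rule frequently_elim1) (rule trop_QGr_tropical_plucker_relations[OF _ ij map])
  with tendsto_coordinate not_MInf tendsto_coordinate not_MInf show ?thesis
    by (rule tropical_plucker_relations_tendsto)
qed

lemma (in nonarch_valued_field) trop_closure_QGr_subset_QDr:
  assumes Q: "quiver_dimvec V Arr src tgt n d"
  shows "trop_closure_QGr val V Arr src tgt A d n \<subseteq> QDr val V Arr src tgt A d n"
proof
  fix x assume x: "x \<in> trop_closure_QGr val V Arr src tgt A d n"
  show "x \<in> QDr val V Arr src tgt A d n"
    unfolding mem_QDr_iff
  proof (intro conjI ballI)
    show "trop_rep V d n x"
      using x by (simp add: trop_closure_QGr_def)
    fix i assume "i \<in> V"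
    then show "tropical_plucker_relations val n (unit_matrix n) (d i) (d i) (x i) (x i)"
    proof (intro trop_closure_QGr_tropical_plucker_relations[OF x])
      fix N assume "N \<in> QGr V Arr src tgt A d n"
      then have "N i \<subseteq> kvecs n"
        using \<open>i \<in> V\<close> by (auto simp: QGr_def intro!: subspace_of_dim_subset_kvecs)
      then show "matvec n (unit_matrix n) ` N i \<subseteq> N i"
        using matvec_unit_matrix by (metis image_subsetI subsetD)
    qed
  next
    fix a assume "a \<in> Arr"
    then show "tropical_plucker_relations val n (A a) (d (src a)) (d (tgt a))
        (x (src a)) (x (tgt a))"
      using Q by (intro trop_closure_QGr_tropical_plucker_relations[OF x])
        (auto simp: quiver_dimvec_def QGr_def)
  qed
qed

subsection \<open>Dimension vectors with entries 0 and n\<close>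

lemma rowcomb_unit_matrix:
  assumes "r \<le> n"
  shows "rowcomb r (unit_matrix n) c = (\<lambda>j. if j < r then c j else 0)"
proof
  fix j
  have "rowcomb r (unit_matrix n) c j = (\<Sum>k<r. if k = j then c k else 0)"
    unfolding rowcomb_def using assms by (intro sum.cong) (auto simp: unit_matrix_def)
  then show "rowcomb r (unit_matrix n) c j = (if j < r then c j else 0)"
    by simp
qed

lemma basis_matrix_unit_matrix:
  assumes "r \<le> n"
  shows "basis_matrix n r (unit_matrix n :: nat \<Rightarrow> nat \<Rightarrow> 'k::field) (kvecs r)"
proof -
  have "v = rowcomb r (unit_matrix n) v" if "v \<in> kvecs r" for v :: "nat \<Rightarrow> 'k"
    using that unfolding rowcomb_unit_matrix[OF assms] by (auto simp: kvecs_def fun_eq_iff)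
  then have "kvecs r = range (rowcomb r (unit_matrix n :: nat \<Rightarrow> nat \<Rightarrow> 'k))"
    by (auto simp: rowcomb_unit_matrix[OF assms] kvecs_def)
  then show ?thesis
    by (auto simp: basis_matrix_def rowcomb_unit_matrix[OF assms] unit_matrix_def fun_eq_iff
        split: if_splits)
qed

lemma plucker_unit_matrix:
  assumes "r \<le> n"
  shows "plucker r (unit_matrix n) {..<r} = (1 :: 'k::field)"
proof -
  have "Matrix.mat r r (\<lambda>(k, l). unit_matrix n k (sorted_list_of_set {..<r} ! l) :: 'k) = 1\<^sub>m r"
    using assms by (intro eq_matI) (auto simp: unit_matrix_def lessThan_atLeast0)
  then show ?thesis
    by (simp add: plucker_def ldet_eq_det)
qed

lemma subsets_of_size_extreme:
  assumes "r \<in> {0, n}"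
  shows "subsets_of_size n r = {{..<r}}"
proof -
  have "I = {..<r}" if "I \<in> subsets_of_size n r" for I
    using that assms finite_subsets_of_sizeD[OF that] card_subset_eq[of "{..<n}" I]
    by (auto simp: subsets_of_size_def)
  moreover have "{..<r} \<in> subsets_of_size n r"
    using assms by (auto simp: subsets_of_size_def)
  ultimately show ?thesis
    by blast
qed

lemma (in nonarch_valued_field) matrix_eq_zero_of_tropical_plucker_relations:
  assumes rel: "tropical_plucker_relations val n A n 0 p q"
    and finite: "p {..<n} \<noteq> \<infinity>" "q {} \<noteq> \<infinity>"
    and jk: "j < n" "k < n"
  shows "A k j = 0"
proof -
  let ?I = "{..<n} - {j}"
  have "?I \<in> subsets_of_size n (n - 1) \<and> 1 \<le> n \<and> {k} \<in> subsets_of_size n (0 + 1)"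
    using jk by (auto simp: subsets_of_size_def)
  then have "min_twice (({..<n} - ?I) \<times> {k})
      (\<lambda>(j, k'). val (A k' j) + p (insert j ?I) + q ({k} - {k'}))"
    using rel unfolding tropical_plucker_relations_def by blast
  moreover have "({..<n} - ?I) \<times> {k} = {(j, k)}" "insert j ?I = {..<n}"
    using jk by auto
  ultimately have "val (A k j) + p {..<n} + q {} = \<infinity>"
    by (simp add: min_twice_singleton)
  with finite show ?thesis
    by (simp add: val_eq_PInf_iff)
qed

lemma trop_rep_extreme_finite:
  assumes "trop_rep V d n x" "i \<in> V" "d i \<in> {0, n}"
  shows "\<bar>x i {..<d i}\<bar> \<noteq> \<infinity>"
proof -
  obtain I where "x i I \<noteq> \<infinity>"
    using assms unfolding trop_rep_def by blast
  moreover have "I = {..<d i}"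
    using assms calculation subsets_of_size_extreme[OF assms(3)] unfolding trop_rep_def by blast
  ultimately show ?thesis
    using assms unfolding trop_rep_def by (auto intro: ereal_infinity_cases)
qed

lemma (in nonarch_valued_field) kvecs_in_QGr_extreme:
  assumes Q: "quiver_dimvec V Arr src tgt n d"
    and extreme: "\<And>i. i \<in> V \<Longrightarrow> d i \<in> {0, n}" and x: "x \<in> QDr val V Arr src tgt A d n"
  shows "(\<lambda>i. kvecs (d i)) \<in> QGr V Arr src tgt A d n"
proof -
  have "subspace_of_dim n (d i) (kvecs (d i))" if "i \<in> V" for i
    using basis_matrix_unit_matrix Q that unfolding quiver_dimvec_def subspace_of_dim_def by blast
  moreover have "matvec n (A a) u \<in> kvecs (d (tgt a))"
    if a: "a \<in> Arr" and u: "u \<in> kvecs (d (src a))" for a u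
  proof -
    have V: "src a \<in> V" "tgt a \<in> V"
      using Q a by (auto simp: quiver_dimvec_def)
    consider (zero_source) "d (src a) = 0" | (full_target) "d (tgt a) = n"
      | (full_to_zero) "d (src a) = n" "d (tgt a) = 0"
      using extreme[OF V(1)] extreme[OF V(2)] by auto
    then show ?thesis
    proof cases
      case zero_source
      with u show ?thesis
        by (auto simp: kvecs_def matvec_def)
    next
      case full_target
      then show ?thesis
        by (auto simp: kvecs_def matvec_def)
    next
      case full_to_zero
      have rep: "trop_rep V d n x"
        and rel: "tropical_plucker_relations val n (A a) n 0 (x (src a)) (x (tgt a))"
        using x a full_to_zero by (force simp: mem_QDr_iff)+
      have "x (src a) {..<n} \<noteq> \<infinity>" "x (tgt a) {} \<noteq> \<infinity>"
        using trop_rep_extreme_finite[OF rep V(1)] trop_rep_extreme_finite[OF rep V(2)]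
          full_to_zero by auto
      then have "A a k j = 0" if "j < n" "k < n" for j k
        using matrix_eq_zero_of_tropical_plucker_relations[OF rel] that by blast
      then show ?thesis
        by (auto simp: kvecs_def matvec_def)
    qed
  qed
  ultimately show ?thesis
    by (auto simp: QGr_def)
qed

lemma (in nonarch_valued_field) QDr_subset_trop_closure_QGr_extreme:
  assumes Q: "quiver_dimvec V Arr src tgt n d"
    and extreme: "\<And>i. i \<in> V \<Longrightarrow> d i \<in> {0, n}"
  shows "QDr val V Arr src tgt A d n \<subseteq> trop_closure_QGr val V Arr src tgt A d n"
proof
  fix x assume x: "x \<in> QDr val V Arr src tgt A d n"
  then have rep: "trop_rep V d n x"
    by (simp add: QDr_def)
  have le: "d i \<le> n" if "i \<in> V" for i
    using Q that by (simp add: quiver_dimvec_def)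
  have "x i I = (if i \<in> V \<and> I \<in> subsets_of_size n (d i)
      then val (plucker (d i) (unit_matrix n) I) + ereal (real_of_ereal (x i {..<d i})) else \<infinity>)"
    for i I
  proof (cases "i \<in> V \<and> I \<in> subsets_of_size n (d i)")
    case True
    then have "I = {..<d i}"
      using subsets_of_size_extreme[OF extreme, of i] by simp
    with True show ?thesis
      using trop_rep_extreme_finite[OF rep _ extreme, of i] le
      by (simp add: plucker_unit_matrix ereal_real)
  qed (use rep in \<open>auto simp: trop_rep_def\<close>)
  moreover have "basis_matrix n (d i) (unit_matrix n) (kvecs (d i))" if "i \<in> V" for i
    using basis_matrix_unit_matrix le that by blast
  ultimately have "x \<in> trop_QGr val V Arr src tgt A d n"
    using kvecs_in_QGr_extreme[OF Q extreme x] unfolding trop_QGr_def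
    by (intro CollectI bexI[of _ "\<lambda>i. kvecs (d i)"] exI[of _ "\<lambda>_. unit_matrix n"]
        exI[of _ "\<lambda>i. real_of_ereal (x i {..<d i})"]) auto
  then show "x \<in> trop_closure_QGr val V Arr src tgt A d n"
    using rep closure_subset by (auto simp: trop_closure_QGr_def)
qed

subsection \<open>Strictness of the containment\<close>

definition uniform_point :: "nat set \<Rightarrow> (nat \<Rightarrow> nat) \<Rightarrow> nat \<Rightarrow> nat \<Rightarrow> nat set \<Rightarrow> ereal" where
  "uniform_point V d n i I = (if i \<in> V \<and> I \<in> subsets_of_size n (d i) then 0 else \<infinity>)"

text \<open>The minimum 0 is attained at the diagonal terms, which are at least two because
  \<open>J\<close> has two more elements than \<open>I\<close>.\<close>
lemma tropical_plucker_relations_uniform: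
  assumes diag: "\<And>k. k < n \<Longrightarrow> val (A k k) = 0"
    and integral: "\<And>j k. j < n \<Longrightarrow> k < n \<Longrightarrow> 0 \<le> val (A k j)"
    and p: "\<And>I. I \<in> subsets_of_size n r \<Longrightarrow> p I = 0"
  shows "tropical_plucker_relations val n A r r p p"
  unfolding tropical_plucker_relations_def
proof (intro allI impI, elim conjE)
  fix I J
  assume I: "I \<in> subsets_of_size n (r - 1)" and r: "1 \<le> r" and J: "J \<in> subsets_of_size n (r + 1)"
  have "2 \<le> card (J - I)"
    using diff_card_le_card_Diff[OF finite_subsets_of_sizeD[OF I], of J] I J r
    by (simp add: subsets_of_size_def)
  then obtain k l where kl: "k \<in> J - I" "l \<in> J - I" "k \<noteq> l"
    by (metis card_2_iff' obtain_subset_with_card_n subsetD)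
  have J_less_n: "k < n" if "k \<in> J" for k
    using J that by (auto simp: subsets_of_size_def)
  have p_insert: "p (insert j I) = 0" if "j < n" "j \<notin> I" for j
    using that I r by (simp add: p insert_in_subsets_of_size)
  have p_diff: "p (J - {k}) = 0" if "k \<in> J" for k
    using that J by (simp add: p diff_in_subsets_of_size)
  show "min_twice (({..<n} - I) \<times> J) (\<lambda>(j, k). val (A k j) + p (insert j I) + p (J - {k}))"
    using kl by (intro min_twiceI[of "(k, k)" _ "(l, l)"])
      (auto simp: J_less_n p_insert p_diff diag integral)
qed

lemma (in nonarch_valued_field) uniform_point_in_QDr:
  assumes Q: "quiver_dimvec V Arr src tgt n d"
    and same_dim: "\<And>a. a \<in> Arr \<Longrightarrow> d (src a) = d (tgt a)"
    and diag: "\<And>a k. a \<in> Arr \<Longrightarrow> k < n \<Longrightarrow> val (A a k k) = 0"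
    and integral: "\<And>a j k. a \<in> Arr \<Longrightarrow> j < n \<Longrightarrow> k < n \<Longrightarrow> 0 \<le> val (A a k j)"
  shows "uniform_point V d n \<in> QDr val V Arr src tgt A d n"
  unfolding mem_QDr_iff
proof (intro conjI ballI)
  have "{..<d i} \<in> subsets_of_size n (d i)" if "i \<in> V" for i
    using Q that by (auto simp: quiver_dimvec_def subsets_of_size_def)
  then show "trop_rep V d n (uniform_point V d n)"
    by (force simp: trop_rep_def uniform_point_def)
next
  fix i assume "i \<in> V"
  then show "tropical_plucker_relations val n (unit_matrix n) (d i) (d i)
      (uniform_point V d n i) (uniform_point V d n i)"
    by (intro tropical_plucker_relations_uniform) (auto simp: uniform_point_def unit_matrix_def)
next
  fix a assume a: "a \<in> Arr"
  have "uniform_point V d n (src a) = uniform_point V d n (tgt a)"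
    using Q a same_dim[OF a] by (auto simp: uniform_point_def quiver_dimvec_def fun_eq_iff)
  moreover have "tropical_plucker_relations val n (A a) (d (tgt a)) (d (tgt a))
      (uniform_point V d n (tgt a)) (uniform_point V d n (tgt a))"
    using Q a by (intro tropical_plucker_relations_uniform diag integral)
      (auto simp: uniform_point_def quiver_dimvec_def)
  ultimately show "tropical_plucker_relations val n (A a) (d (src a)) (d (tgt a))
      (uniform_point V d n (src a)) (uniform_point V d n (tgt a))"
    by (simp add: same_dim[OF a])
qed

lemma (in nonarch_valued_field) trop_closure_QGr_coordinate_eq_PInf:
  assumes x: "x \<in> trop_closure_QGr val V Arr src tgt A d n"
    and i: "i \<in> V" and I: "I \<in> subsets_of_size n (d i)"
    and plucker: "\<And>N M. N \<in> QGr V Arr src tgt A d n \<Longrightarrow> basis_matrix n (d i) M (N i) \<Longrightarrow>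
      plucker (d i) M I = 0"
  shows "x i I = \<infinity>"
proof -
  have "trop_QGr val V Arr src tgt A d n \<subseteq> {y. y i I = \<infinity>}"
  proof
    fix y assume "y \<in> trop_QGr val V Arr src tgt A d n"
    then show "y \<in> {y. y i I = \<infinity>}"
      by (rule trop_QGrE) (use i I plucker in simp)
  qed
  moreover have "closed {y :: nat \<Rightarrow> nat set \<Rightarrow> ereal. y i I = \<infinity>}"
    by (intro closed_Collect_eq continuous_on_const
        continuous_on_product_then_coordinatewise[OF continuous_on_product_coordinates])
  ultimately show ?thesis
    using x closure_minimal unfolding trop_closure_QGr_def by blast
qed

lemma plucker_one: "plucker 1 M {j} = M 0 j"
  by (simp add: plucker_def ldet_eq_det det_single)

definition shear :: "nat \<Rightarrow> nat \<Rightarrow> 'k::field" where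
  "shear i j = (if i = j \<or> i = 0 \<and> j = 1 then 1 else 0)"

lemma matvec_shear:
  assumes "2 \<le> n"
  shows "matvec n shear u 0 = u 0 + u 1" "matvec n shear u 1 = u 1"
proof -
  have "(\<Sum>j<n. shear 0 j * u j) = (\<Sum>j<n. (if j = 0 then u j else 0) + (if j = 1 then u j else 0))"
    by (intro sum.cong) (auto simp: shear_def)
  then show "matvec n shear u 0 = u 0 + u 1"
    using assms by (simp add: matvec_def sum.distrib)
  have "(\<Sum>j<n. shear 1 j * u j) = (\<Sum>j<n. if j = 1 then u j else 0)"
    by (intro sum.cong) (auto simp: shear_def)
  then show "matvec n shear u 1 = u 1"
    using assms by (simp add: matvec_def)
qed

lemma basis_shear_invariant_line_eq_zero:
  assumes n: "2 \<le> n" and M: "basis_matrix n 1 M N" and inv: "matvec n shear ` N \<subseteq> N"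
  shows "M 0 1 = (0 :: 'k::field)"
proof -
  have N: "N = range (\<lambda>(b :: nat \<Rightarrow> 'k) j. b 0 * M 0 j)"
    using M by (simp add: basis_matrix_def rowcomb_def[abs_def])
  have "M 0 \<in> N"
    unfolding N by (rule range_eqI[of _ _ "\<lambda>_. 1"]) simp
  then have "matvec n shear (M 0) \<in> N"
    using inv by blast
  then obtain b where b: "matvec n shear (M 0) = (\<lambda>j. b 0 * M 0 j)"
    unfolding N by auto
  have "M 0 0 + M 0 1 = b 0 * M 0 0" "M 0 1 = b 0 * M 0 1"
    using matvec_shear[OF n, of "M 0"] unfolding b by simp_all
  then show ?thesis
    by (cases "M 0 1 = 0") auto
qed

lemma quiver_dimvec_loop:
  assumes "r \<le> n"
  shows "quiver_dimvec {0} {0} (\<lambda>_. 0) (\<lambda>_. 0) n (\<lambda>_. r)"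
  using assms by (simp add: quiver_dimvec_def)

lemma (in nonarch_valued_field) trop_closure_QGr_shear_psubset_QDr:
  assumes n: "2 \<le> n"
  shows "trop_closure_QGr val {0} {0} (\<lambda>_. 0) (\<lambda>_. 0) (\<lambda>_. shear) (\<lambda>_. 1) n
    \<subset> QDr val {0} {0} (\<lambda>_. 0) (\<lambda>_. 0) (\<lambda>_. shear) (\<lambda>_. 1) n" (is "?G \<subset> ?D")
proof -
  have Q: "quiver_dimvec {0} {0} (\<lambda>_. 0) (\<lambda>_. 0) n (\<lambda>_. 1)"
    using n by (intro quiver_dimvec_loop) simp
  let ?x = "uniform_point {0} (\<lambda>_. 1) n"
  have "?x \<in> ?D"
    using Q by (intro uniform_point_in_QDr) (auto simp: shear_def)
  moreover have "?x \<notin> ?G"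
  proof
    assume x: "?x \<in> ?G"
    have sing: "{1} \<in> subsets_of_size n 1"
      using n by (simp add: subsets_of_size_def)
    have "?x 0 {1} = \<infinity>"
    proof (rule trop_closure_QGr_coordinate_eq_PInf[OF x])
      fix N M
      assume "N \<in> QGr {0} {0} (\<lambda>_. 0) (\<lambda>_. 0) (\<lambda>_. shear :: nat \<Rightarrow> nat \<Rightarrow> 'k) (\<lambda>_. 1) n"
        and "basis_matrix n 1 M (N 0)"
      then show "plucker 1 M {1} = 0"
        unfolding plucker_one using basis_shear_invariant_line_eq_zero[OF n] by (auto simp: QGr_def)
    qed (use sing in auto)
    with sing show False
      by (simp add: uniform_point_def)
  qed
  ultimately show ?thesis
    using trop_closure_QGr_subset_QDr[OF Q] by blast
qed

theorem theoremD:
  fixes val :: "'k::field \<Rightarrow> ereal"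
  assumes "alg_closed TYPE('k)"
    and "nonarch_valuation val"
    and "nontrivial_valuation val"
  shows "(\<forall>V Arr src tgt A d. quiver_dimvec V Arr src tgt 1 d \<longrightarrow>
            QDr val V Arr src tgt A d 1 = trop_closure_QGr val V Arr src tgt A d 1)
       \<and> (\<forall>n\<ge>2.
            (\<forall>V Arr src tgt A d. quiver_dimvec V Arr src tgt n d \<longrightarrow>
               trop_closure_QGr val V Arr src tgt A d n \<subseteq> QDr val V Arr src tgt A d n)
          \<and> (\<exists>V Arr src tgt A d. quiver_dimvec V Arr src tgt n d \<and>
               trop_closure_QGr val V Arr src tgt A d n \<subset> QDr val V Arr src tgt A d n))"
proof -
  interpret nonarch_valued_field val
    using assms(2) by unfold_locales
  show ?thesis
  proof (intro conjI allI impI)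
    fix V Arr src tgt d and A :: "nat \<Rightarrow> nat \<Rightarrow> nat \<Rightarrow> 'k"
    assume Q: "quiver_dimvec V Arr src tgt 1 d"
    then have "d i \<in> {0, 1}" if "i \<in> V" for i
      using that by (force simp: quiver_dimvec_def)
    with Q show "QDr val V Arr src tgt A d 1 = trop_closure_QGr val V Arr src tgt A d 1"
      by (intro equalityI QDr_subset_trop_closure_QGr_extreme trop_closure_QGr_subset_QDr)
  next
    fix n :: nat and V Arr src tgt d and A :: "nat \<Rightarrow> nat \<Rightarrow> nat \<Rightarrow> 'k"
    assume "quiver_dimvec V Arr src tgt n d"
    then show "trop_closure_QGr val V Arr src tgt A d n \<subseteq> QDr val V Arr src tgt A d n"
      by (rule trop_closure_QGr_subset_QDr)
  next
    fix n :: nat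
    assume "2 \<le> n"
    then show "\<exists>V Arr src tgt A d. quiver_dimvec V Arr src tgt n d \<and>
        trop_closure_QGr val V Arr src tgt A d n \<subset> QDr val V Arr src tgt A d n"
      using quiver_dimvec_loop[of 1 n] trop_closure_QGr_shear_psubset_QDr[of n] by fastforce
  qed
qed

end
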